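(* Let $\mathcal{S}=(\mathcal{X},\mathcal{X}_0,w,f)$ be a discrete-time stochastic dynamical system, and let $\mathcal{X}_u\subseteq\mathcal{X}$ be a set of unsafe states. Let $0\le\gamma\le 1$, $\ell\in\mathbb{N}$, $k\in\mathbb{N}_{\ge 1}$, $c\in\mathbb{R}_{\ge 0}$, and $\alpha_i\in\mathbb{R}_{>0}$ for $0\le i<\ell$. Suppose that functions $\mathcal{B}_i:\mathcal{X}\to\mathbb{R}$, $0\le i\le\ell$, form a $k$-inductive interpolation-inspired barrier certificate of the first kind ($k$-IBC v1) for $\mathcal{S}$ with these constants, that is: \begin{align*} &\mathcal{B}_i(x)\ge 0 && \forall x\in\mathcal{X},\ 0\le i\le\ell,\\ &\mathcal{B}_0(x)\le\gamma && \forall x\in\mathcal{X}_0,\\ &\mathcal{B}_i(x)\ge 1 && \forall x\in\mathcal{X}_u,\ 0\le i\le\ell,\\ &\mathbb{E}[\mathcal{B}_{i+1}(f(x,w))\mid x]\le\alpha_i\mathcal{B}_i(x) && \forall x\in\mathcal{X}\setminus\mathcal{X}_u,\ 0\le i<\ell,\\ &\mathbb{E}[\mathcal{B}_\ell(f(x,w))\mid x]\le\mathcal{B}_\ell(x)+c && \forall x\in\mathcal{X}\setminus\mathcal{X}_u,\\ &\mathbb{E}[\mathcal{B}_\ell(f^k(x,w_k))\mid x]\le\mathcal{B}_\ell(x) && \forall x\in\mathcal{X}\setminus\mathcal{X}_u. \end{align*} Then for every initial state $x_0\in\mathcal{X}_0$, the solution process $\mathbf{x}_{x_0}$ starting from $x_0$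 satisfies $$\mathbb{P}\{\mathbf{x}_{x_0}(t)\notin\mathcal{X}_u,\ \forall t\in\mathbb{N}\}\ \ge\ 1-\gamma\left(1+k\prod_{i=0}^{\ell-1}\alpha_i+\sum_{t=0}^{\ell-2}\prod_{i=0}^{t}\alpha_i\right)-\frac{k(k-1)c}{2}.$$
   Context: A discrete-time stochastic dynamical system is a tuple $\mathcal{S}=(\mathcal{X},\mathcal{X}_0,w,f)$ where $\mathcal{X}\subseteq\mathbb{R}^n$ is a Borel space (the state set), $\mathcal{X}_0\subseteq\mathcal{X}$ is the set of initial states, $w=\{w(t):\Omega\to\mathcal{W},\ t\in\mathbb{N}\}$ is a sequence of i.i.d. random variables from a probability space $(\Omega,\mathcal{F},\mathbb{P})$ to a measurable space $(\mathcal{W},\mathcal{F}_w)$, and $f:\mathcal{X}\times\mathcal{W}\to\mathcal{X}$ is a measurable map (so $\mathcal{X}$ is forward invariant). The dynamics is $x(t+1)=f(x(t),w(t))$, $t\in\mathbb{N}$, where $\mathbb{N}$ includes $0$. For $x_0\in\mathcal{X}_0$, $\mathbf{x}_{x_0}=(x(0),x(1),\dots)$ denotes the solution process with $x(0)=x_0$, and $\mathbf{x}_{x_0}(t)=x(t)$. For $i\ge 1$, $f^i:\mathcal{X}\times\mathcal{W}^i\to\mathcal{X}$ is the $i$-fold composition: $f^1(x,a_0)=f(x,a_0)$ and $f^i(x,(a_0,\dots,a_{i-1}))=f(f^{i-1}(x,(a_0,\dots,a_{i-2})),a_{i-1})$ for $i>1$. The symbol $w_i$ denotes a vector of $i$ consecutive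 noise terms, $w_i(t)=[w(t);\dots;w(t+i-1)]$ (i.e. $i$ i.i.d. copies of the noise), so that $x(t+i)=f^i(x(t),w_i(t))$. For a function $\mathcal{B}$ on $\mathcal{X}$, $\mathbb{E}[\mathcal{B}(f(x,w))\mid x]$ and $\mathbb{E}[\mathcal{B}(f^k(x,w_k))\mid x]$ denote the expectations over the noise $w$ (distributed as $w(t)$), respectively the noise vector $w_k$, with the state $x$ fixed. The set $\mathcal{X}_u$ and the functions $\mathcal{B}_i$ are Borel measurable. Empty products equal $1$ and empty sums equal $0$. *)

theory Defs
  imports "HOL-Probability.Probability"
begin

text \<open>Only the measurable-space structure of \<open>W\<close> is used; the measure it carries is irrelevant.
  The state set \<open>X\<close> carries the Borel sigma-algebra it inherits from the ambient Euclidean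
  space.\<close>

locale stochastic_system = prob_space M
  for M :: "'o measure"
    and X :: "(real ^ 'n) set"
    and X0 :: "(real ^ 'n) set"
    and W :: "'w measure"
    and w :: "nat \<Rightarrow> 'o \<Rightarrow> 'w"
    and f :: "(real ^ 'n) \<times> 'w \<Rightarrow> real ^ 'n" +
  assumes state_borel: "X \<in> sets borel"
    and init_subset: "X0 \<subseteq> X"
    and noise_indep: "indep_vars (\<lambda>_. W) w UNIV"
    and noise_ident: "\<And>s t. distr M W (w s) = distr M W (w t)"
    and dyn_measurable: "f \<in> restrict_space borel X \<Otimes>\<^sub>M W \<rightarrow>\<^sub>M restrict_space borel X"

primrec solution :: "('s \<times> 'w \<Rightarrow> 's) \<Rightarrow> (nat \<Rightarrow> 'o \<Rightarrow> 'w) \<Rightarrow> 's \<Rightarrow> nat \<Rightarrow> 'o \<Rightarrow> 's" where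
  "solution f w x0 0 \<omega> = x0"
| "solution f w x0 (Suc t) \<omega> = f (solution f w x0 t \<omega>, w t \<omega>)"

text \<open>The \<open>i\<close>-fold composition of \<open>f\<close>. A noise vector in \<open>W\<^sup>i\<close> is a function on
  \<open>nat\<close> of which only the values at \<open>0, \<dots>, i - 1\<close> are used. The recursion starts from the
  identity at \<open>i = 0\<close>, so that \<open>i = 1\<close> gives \<open>f (x, a 0)\<close>.\<close>

primrec iter_map :: "('s \<times> 'w \<Rightarrow> 's) \<Rightarrow> nat \<Rightarrow> 's \<Rightarrow> (nat \<Rightarrow> 'w) \<Rightarrow> 's" where
  "iter_map f 0 x a = x"
| "iter_map f (Suc i) x a = f (iter_map f i x a, a i)"

definition noise_vec :: "(nat \<Rightarrow> 'o \<Rightarrow> 'w) \<Rightarrow> nat \<Rightarrow> nat \<Rightarrow> 'o \<Rightarrow> nat \<Rightarrow> 'w" where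
  "noise_vec w i t \<omega> = (\<lambda>j\<in>{..<i}. w (t + j) \<omega>)"

text \<open>The expectations are those of nonnegative random variables, so they are taken in
  \<open>[0, \<infinity>]\<close>: the Bochner integral would be \<open>0\<close> for a non-integrable function and would make
  the inequalities hold vacuously. As the noise is i.i.d., the noise (vector) at time \<open>0\<close>
  serves as the generic copy.\<close>

definition k_IBC_v1 ::
  "'o measure \<Rightarrow> 's set \<Rightarrow> 's set \<Rightarrow> (nat \<Rightarrow> 'o \<Rightarrow> 'w) \<Rightarrow> ('s \<times> 'w \<Rightarrow> 's) \<Rightarrow> 's set \<Rightarrow>
   real \<Rightarrow> nat \<Rightarrow> nat \<Rightarrow> real \<Rightarrow> (nat \<Rightarrow> real) \<Rightarrow> (nat \<Rightarrow> 's \<Rightarrow> real) \<Rightarrow> bool" where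
  "k_IBC_v1 M X X0 w f Xu \<gamma> l k c \<alpha> B \<longleftrightarrow>
     (\<forall>x\<in>X. \<forall>i\<le>l. B i x \<ge> 0) \<and>
     (\<forall>x\<in>X0. B 0 x \<le> \<gamma>) \<and>
     (\<forall>x\<in>Xu. \<forall>i\<le>l. B i x \<ge> 1) \<and>
     (\<forall>x\<in>X - Xu. \<forall>i<l.
        (\<integral>\<^sup>+\<omega>. ennreal (B (Suc i) (f (x, w 0 \<omega>))) \<partial>M) \<le> ennreal (\<alpha> i * B i x)) \<and>
     (\<forall>x\<in>X - Xu.
        (\<integral>\<^sup>+\<omega>. ennreal (B l (f (x, w 0 \<omega>))) \<partial>M) \<le> ennreal (B l x + c)) \<and>
     (\<forall>x\<in>X - Xu.
        (\<integral>\<^sup>+\<omega>. ennreal (B l (iter_map f k x (noise_vec w k 0 \<omega>))) \<partial>M) \<le> ennreal (B l x))"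

end

theory Submission
  imports Defs
begin

text \<open>Until time \<open>l\<close> the chain \<open>B 0, \<dots>, B l\<close> bounds the probability of each first visit to
  \<open>Xu\<close> by Markov's inequality. From time \<open>l\<close> on, the times split into the \<open>k\<close> residue classes
  \<open>l + j, l + j + k, l + j + 2 * k, \<dots>\<close>. Along each of them \<open>B l\<close>, stopped at the first
  \<^emph>\<open>sampled\<close> visit to \<open>Xu\<close>, is a nonnegative supermartingale, so Ville's inequality bounds the
  probability of a sampled visit by the mean of \<open>B l\<close> at time \<open>l + j\<close>, and this mean has grown
  by at most \<open>j * c\<close> since time \<open>l\<close>. All expectations are restricted to the event that \<open>Xu\<close> has
  been avoided so far, since the drift conditions only hold outside \<open>Xu\<close>.\<close>

section \<open>The iterated map and the flow property of the solution\<close>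

lemma measurable_iter_map:
  assumes f: "f \<in> S \<Otimes>\<^sub>M W \<rightarrow>\<^sub>M S" and "{..<m} \<subseteq> I"
  shows "(\<lambda>(x, a). iter_map f m x a) \<in> S \<Otimes>\<^sub>M PiM I (\<lambda>_. W) \<rightarrow>\<^sub>M S"
  using assms(2)
proof (induction m)
  case 0
  then show ?case by simp
next
  case (Suc m)
  have "(\<lambda>(x, a). iter_map f m x a) \<in> S \<Otimes>\<^sub>M PiM I (\<lambda>_. W) \<rightarrow>\<^sub>M S"
    using Suc.prems by (intro Suc.IH) auto
  moreover have "m \<in> I"
    using Suc.prems by auto
  then have "(\<lambda>p. snd p m) \<in> S \<Otimes>\<^sub>M PiM I (\<lambda>_. W) \<rightarrow>\<^sub>M W"
    by measurable
  ultimately have "(\<lambda>p. f (case p of (x, a) \<Rightarrow> iter_map f m x a, snd p m))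
      \<in> S \<Otimes>\<^sub>M PiM I (\<lambda>_. W) \<rightarrow>\<^sub>M S"
    by (intro measurable_compose[OF _ f] measurable_Pair)
  then show ?case by (simp add: case_prod_unfold)
qed

text \<open>Flow property. Letting the vector be longer than \<open>m\<close> allows every state up
  to time \<open>n\<close> to be read off the single vector \<open>noise_vec w n 0\<close>.\<close>

lemma solution_add:
  "m \<le> i \<Longrightarrow> solution f w x0 (n + m) \<omega> = iter_map f m (solution f w x0 n \<omega>) (noise_vec w i n \<omega>)"
  by (induction m) (auto simp: noise_vec_def)

lemma solution_eq_iter_map:
  "m \<le> i \<Longrightarrow> solution f w x0 m \<omega> = iter_map f m x0 (noise_vec w i 0 \<omega>)"
  using solution_add[of m i f w x0 0 \<omega>] by simp

section \<open>Law and independence of noise vectors\<close>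

context stochastic_system
begin

abbreviation "S \<equiv> restrict_space borel X"

lemma space_S [simp]: "space S = X"
  by (simp add: space_restrict_space)

lemma measurable_noise [measurable]: "w i \<in> M \<rightarrow>\<^sub>M W"
  using noise_indep by (auto simp: indep_vars_def)

lemma measurable_noise_vec [measurable]: "noise_vec w m n \<in> M \<rightarrow>\<^sub>M PiM {..<m} (\<lambda>_. W)"
  unfolding noise_vec_def by measurable

lemma measurable_solution [measurable]:
  assumes "x0 \<in> X"
  shows "solution f w x0 n \<in> M \<rightarrow>\<^sub>M S"
proof -
  have "(\<lambda>\<omega>. (x0, noise_vec w n 0 \<omega>)) \<in> M \<rightarrow>\<^sub>M S \<Otimes>\<^sub>M PiM {..<n} (\<lambda>_. W)"
    using assms by (intro measurable_Pair measurable_const) simp_all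
  from measurable_compose[OF this measurable_iter_map[OF dyn_measurable subset_refl]]
  show ?thesis by (simp add: solution_eq_iter_map[symmetric])
qed

lemma solution_in_X: "x0 \<in> X \<Longrightarrow> \<omega> \<in> space M \<Longrightarrow> solution f w x0 n \<omega> \<in> X"
  using measurable_space[OF measurable_solution] by simp

text \<open>Stationarity: the start time \<open>n\<close> is absent from the right-hand side, so a
  vector at any time has the law of the one at time \<open>0\<close>, in which the certificate is
  stated.\<close>

lemma distr_noise_vec:
  "distr M (PiM {..<m} (\<lambda>_. W)) (noise_vec w m n) = PiM {..<m} (\<lambda>_. distr M W (w 0))"
proof -
  let ?D = "distr M W (w 0)"
  interpret D: prob_space ?D by (rule prob_space_distr) simp
  \<comment> \<open>The law of the whole sequence comes first: every noise vector is then a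
    coordinate projection of it along the injective shift from \<open>j\<close> to
    \<open>n + j\<close>.\<close>
  have "distr M (PiM UNIV (\<lambda>_. W)) (\<lambda>\<omega>. \<lambda>i\<in>UNIV. w i \<omega>) = PiM UNIV (\<lambda>i. distr M W (w i))"
    using noise_indep by (subst (asm) indep_vars_iff_distr_eq_PiM') auto
  also have "\<dots> = PiM UNIV (\<lambda>_. ?D)"
    by (intro PiM_cong refl noise_ident)
  finally have all: "distr M (PiM UNIV (\<lambda>_. W)) (\<lambda>\<omega>. \<lambda>i\<in>UNIV. w i \<omega>) = PiM UNIV (\<lambda>_. ?D)" .
  have "PiM {..<m} (\<lambda>_. ?D)
      = distr (PiM UNIV (\<lambda>_. ?D)) (PiM {..<m} (\<lambda>_. ?D)) (\<lambda>a. \<lambda>j\<in>{..<m}. a (n + j))"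
    by (rule distr_PiM_reindex[symmetric]) (auto intro: D.prob_space_axioms)
  also have "\<dots> = distr (PiM UNIV (\<lambda>_. ?D)) (PiM {..<m} (\<lambda>_. W)) (\<lambda>a. \<lambda>j\<in>{..<m}. a (n + j))"
    by (intro distr_cong refl sets_PiM_cong) auto
  also have "\<dots> = distr M (PiM {..<m} (\<lambda>_. W)) (noise_vec w m n)"
    unfolding all[symmetric] by (subst distr_distr) (auto simp: comp_def noise_vec_def intro!: distr_cong)
  finally show ?thesis ..
qed

text \<open>The two vectors are functions of the disjoint index blocks \<open>{..<n}\<close> and
  \<open>{n..}\<close> of an independent family.\<close>

lemma indep_var_noise_vec:
  "indep_var (PiM {..<n} (\<lambda>_. W)) (noise_vec w n 0) (PiM {..<m} (\<lambda>_. W)) (noise_vec w m n)"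
proof -
  let ?N = "\<lambda>I. PiM I (\<lambda>_. W)"
  have "indep_var (?N {..<n}) (\<lambda>\<omega>. \<lambda>i\<in>{..<n}. w i \<omega>) (?N {n..}) (\<lambda>\<omega>. \<lambda>i\<in>{n..}. w i \<omega>)"
    by (rule indep_var_restrict[OF noise_indep]) auto
  then have "indep_var (?N {..<n}) (id \<circ> (\<lambda>\<omega>. \<lambda>i\<in>{..<n}. w i \<omega>))
      (?N {..<m}) ((\<lambda>a. \<lambda>j\<in>{..<m}. a (n + j)) \<circ> (\<lambda>\<omega>. \<lambda>i\<in>{n..}. w i \<omega>))"
    by (rule indep_var_compose) (auto intro!: measurable_restrict measurable_component_singleton)
  also have "id \<circ> (\<lambda>\<omega>. \<lambda>i\<in>{..<n}. w i \<omega>) = noise_vec w n 0"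
    by (auto simp: noise_vec_def)
  also have "(\<lambda>a. \<lambda>j\<in>{..<m}. a (n + j)) \<circ> (\<lambda>\<omega>. \<lambda>i\<in>{n..}. w i \<omega>) = noise_vec w m n"
    by (auto simp: noise_vec_def fun_eq_iff)
  finally show ?thesis .
qed

text \<open>Markov property in integrated form: by independence and stationarity, the noise from
  time \<open>n\<close> on may be replaced by a fresh copy of the noise at time \<open>0\<close>,
  integrated with the past held fixed.\<close>

lemma nn_integral_past_future:
  assumes F [measurable]: "F \<in> borel_measurable (PiM {..<n} (\<lambda>_. W) \<Otimes>\<^sub>M PiM {..<m} (\<lambda>_. W))"
  shows "(\<integral>\<^sup>+\<omega>. F (noise_vec w n 0 \<omega>, noise_vec w m n \<omega>) \<partial>M)
    = (\<integral>\<^sup>+\<omega>. \<integral>\<^sup>+\<omega>'. F (noise_vec w n 0 \<omega>, noise_vec w m 0 \<omega>') \<partial>M \<partial>M)"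
proof -
  let ?N = "\<lambda>I. PiM I (\<lambda>_. W)"
  let ?P = "distr M (?N {..<n}) (noise_vec w n 0)" and ?Q = "distr M (?N {..<m}) (noise_vec w m 0)"
  interpret Q: prob_space ?Q by (rule prob_space_distr) simp
  have Q: "distr M (?N {..<m}) (noise_vec w m n) = ?Q"
    by (simp add: distr_noise_vec)
  have "distr M (?N {..<n} \<Otimes>\<^sub>M ?N {..<m}) (\<lambda>\<omega>. (noise_vec w n 0 \<omega>, noise_vec w m n \<omega>)) = ?P \<Otimes>\<^sub>M ?Q"
    using indep_var_noise_vec[of n m] unfolding indep_var_distribution_eq Q by simp
  then have "(\<integral>\<^sup>+\<omega>. F (noise_vec w n 0 \<omega>, noise_vec w m n \<omega>) \<partial>M) = integral\<^sup>N (?P \<Otimes>\<^sub>M ?Q) F"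
    by (simp add: nn_integral_distr flip: \<open>distr _ _ _ = ?P \<Otimes>\<^sub>M ?Q\<close>)
  also have "\<dots> = (\<integral>\<^sup>+a. \<integral>\<^sup>+b. F (a, b) \<partial>?Q \<partial>?P)"
    by (rule Q.nn_integral_fst[symmetric]) simp
  also have "\<dots> = (\<integral>\<^sup>+\<omega>. \<integral>\<^sup>+b. F (noise_vec w n 0 \<omega>, b) \<partial>?Q \<partial>M)"
    by (rule nn_integral_distr) (auto intro!: Q.borel_measurable_nn_integral_fst)
  also have "\<dots> = (\<integral>\<^sup>+\<omega>. \<integral>\<^sup>+\<omega>'. F (noise_vec w n 0 \<omega>, noise_vec w m 0 \<omega>') \<partial>M \<partial>M)"
    by (intro nn_integral_cong nn_integral_distr) measurable
  finally show ?thesis .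
qed

section \<open>Expectations restricted to avoidance events\<close>

context
  fixes Xu :: "(real ^ 'n) set" and x0 :: "real ^ 'n"
  assumes unsafe_borel: "Xu \<in> sets borel" and unsafe_subset: "Xu \<subseteq> X" and x0: "x0 \<in> X"
begin

abbreviation "sol \<equiv> solution f w x0"

text \<open>The watched times form an arbitrary set because the \<open>k\<close>-step argument
  watches an initial segment and from then on only every \<open>k\<close>-th time.\<close>

definition avoid :: "nat set \<Rightarrow> 'o set" where
  "avoid J = {\<omega> \<in> space M. \<forall>t\<in>J. sol t \<omega> \<notin> Xu}"

text \<open>The indicator kills the process: paths that visit \<open>Xu\<close> at a watched time
  contribute nothing. Values in \<open>ennreal\<close> avoid integrability conditions.\<close>

definition mean :: "nat set \<Rightarrow> nat \<Rightarrow> (real ^ 'n \<Rightarrow> ennreal) \<Rightarrow> ennreal" where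
  "mean J n g = (\<integral>\<^sup>+\<omega>. indicator (avoid J) \<omega> * g (sol n \<omega>) \<partial>M)"

lemma unsafe_sets [measurable]: "Xu \<in> sets S"
  using unsafe_borel unsafe_subset state_borel by (auto simp: sets_restrict_space_iff)

lemma measurable_sol [measurable]: "sol n \<in> M \<rightarrow>\<^sub>M S"
  using x0 by simp

lemma avoid_sets [measurable]: "avoid J \<in> sets M"
  unfolding avoid_def by measurable

lemma mean_mono:
  assumes "J' \<subseteq> J" and "\<And>x. x \<in> X \<Longrightarrow> g x \<le> h x"
  shows "mean J n g \<le> mean J' n h"
  unfolding mean_def using assms solution_in_X[OF x0]
  by (intro nn_integral_mono mult_mono) (auto simp: avoid_def indicator_def)

lemma mean_cmult:
  assumes [measurable]: "g \<in> borel_measurable S"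
  shows "mean J n (\<lambda>x. a * g x) = a * mean J n g"
proof -
  have "mean J n (\<lambda>x. a * g x) = (\<integral>\<^sup>+\<omega>. a * (indicator (avoid J) \<omega> * g (sol n \<omega>)) \<partial>M)"
    by (simp add: mean_def mult_ac)
  then show ?thesis
    by (simp add: mean_def nn_integral_cmult)
qed

lemma mean_add_const_le:
  assumes [measurable]: "g \<in> borel_measurable S"
  shows "mean J n (\<lambda>x. g x + a) \<le> mean J n g + a"
proof -
  have "mean J n (\<lambda>x. g x + a) \<le> (\<integral>\<^sup>+\<omega>. indicator (avoid J) \<omega> * g (sol n \<omega>) + a \<partial>M)"
    unfolding mean_def by (intro nn_integral_mono) (auto simp: indicator_def)
  also have "\<dots> = mean J n g + a"
    by (subst nn_integral_add) (auto simp: mean_def emeasure_space_1)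
  finally show ?thesis .
qed

text \<open>The conditions on \<open>J\<close> do separate work: \<open>J \<subseteq> {..n}\<close>
  makes the event a function of the noise before time \<open>n\<close>, hence independent of the
  next \<open>m\<close> terms, and \<open>n \<in> J\<close> keeps the state at time \<open>n\<close>
  out of \<open>Xu\<close>, where \<open>drift\<close> applies.\<close>

lemma mean_drift:
  assumes J: "J \<subseteq> {..n}" "n \<in> J"
    and g [measurable]: "g \<in> borel_measurable S"
    and drift: "\<And>x. x \<in> X - Xu \<Longrightarrow> (\<integral>\<^sup>+\<omega>. g (iter_map f m x (noise_vec w m 0 \<omega>)) \<partial>M) \<le> h x"
  shows "mean J (n + m) g \<le> mean J n h"
proof -
  let ?N = "\<lambda>n. PiM {..<n} (\<lambda>_. W)"
  define A where "A = {a \<in> space (?N n). \<forall>t\<in>J. iter_map f t x0 a \<notin> Xu}"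
  define F where "F = (\<lambda>(a, b). indicator A a * g (iter_map f m (iter_map f n x0 a) b))"
  \<comment> \<open>The event involves the states at all times up to \<open>n\<close>, so
    measurability is needed also for vectors longer than \<open>t\<close>.\<close>
  have past: "(\<lambda>a. iter_map f t x0 a) \<in> ?N n \<rightarrow>\<^sub>M S" if "t \<le> n" for t
  proof -
    have *: "(\<lambda>a. (x0, a)) \<in> ?N n \<rightarrow>\<^sub>M S \<Otimes>\<^sub>M ?N n"
      using x0 by (intro measurable_Pair measurable_const) simp_all
    have "(\<lambda>(x, a). iter_map f t x a) \<in> S \<Otimes>\<^sub>M ?N n \<rightarrow>\<^sub>M S"
      using that by (intro measurable_iter_map dyn_measurable) auto
    from measurable_compose[OF * this] show ?thesis
      by simp
  qed
  have [measurable]: "A \<in> sets (?N n)"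
  proof -
    have "A = space (?N n) - (\<Union>t\<in>J. (\<lambda>a. iter_map f t x0 a) -` Xu \<inter> space (?N n))"
      by (auto simp: A_def)
    also have "\<dots> \<in> sets (?N n)"
      using J by (intro sets.Diff sets.top sets.countable_UN'' measurable_sets[OF past unsafe_sets]) auto
    finally show ?thesis .
  qed
  have [measurable]: "F \<in> borel_measurable (?N n \<Otimes>\<^sub>M ?N m)"
  proof -
    have "(\<lambda>p. (iter_map f n x0 (fst p), snd p)) \<in> ?N n \<Otimes>\<^sub>M ?N m \<rightarrow>\<^sub>M S \<Otimes>\<^sub>M ?N m"
      by (intro measurable_Pair measurable_compose[OF measurable_fst past] measurable_snd) simp
    from measurable_compose[OF this measurable_iter_map[OF dyn_measurable subset_refl]]
    have [measurable]: "(\<lambda>p. iter_map f m (iter_map f n x0 (fst p)) (snd p)) \<in> ?N n \<Otimes>\<^sub>M ?N m \<rightarrow>\<^sub>M S"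
      by simp
    show ?thesis
      unfolding F_def case_prod_unfold by measurable
  qed
  have state: "iter_map f t x0 (noise_vec w n 0 \<omega>) = sol t \<omega>" if "t \<le> n" for t \<omega>
    using solution_eq_iter_map[OF that, of f w x0 \<omega>] by simp
  have A: "indicator A (noise_vec w n 0 \<omega>) = (indicator (avoid J) \<omega> :: ennreal)" if "\<omega> \<in> space M" for \<omega>
    using J that measurable_space[OF measurable_noise_vec that]
    by (auto simp: A_def avoid_def indicator_def state subset_eq)
  have "mean J (n + m) g = (\<integral>\<^sup>+\<omega>. F (noise_vec w n 0 \<omega>, noise_vec w m n \<omega>) \<partial>M)"
    unfolding mean_def F_def
    by (intro nn_integral_cong) (simp add: A state solution_add[OF order_refl])
  also have "\<dots> = (\<integral>\<^sup>+\<omega>. \<integral>\<^sup>+\<omega>'. F (noise_vec w n 0 \<omega>, noise_vec w m 0 \<omega>') \<partial>M \<partial>M)"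
    by (rule nn_integral_past_future) measurable
  also have "\<dots> \<le> mean J n h"
    unfolding mean_def
  proof (intro nn_integral_mono)
    fix \<omega> assume \<omega>: "\<omega> \<in> space M"
    show "(\<integral>\<^sup>+\<omega>'. F (noise_vec w n 0 \<omega>, noise_vec w m 0 \<omega>') \<partial>M) \<le> indicator (avoid J) \<omega> * h (sol n \<omega>)"
    proof (cases "\<omega> \<in> avoid J")
      case True
      then have "sol n \<omega> \<in> X - Xu"
        using J solution_in_X[OF x0 \<omega>] by (auto simp: avoid_def)
      from drift[OF this] show ?thesis
        using True by (simp add: F_def A[OF \<omega>] state)
    qed (simp add: F_def A[OF \<omega>])
  qed
  finally show ?thesis .
qed

lemma mean_drift_one:
  assumes "J \<subseteq> {..n}" "n \<in> J" "g \<in> borel_measurable S"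
    and "\<And>x. x \<in> X - Xu \<Longrightarrow> (\<integral>\<^sup>+\<omega>. g (f (x, w 0 \<omega>)) \<partial>M) \<le> h x"
  shows "mean J (Suc n) g \<le> mean J n h"
  using mean_drift[OF assms(1-3), of 1 h] assms(4) by (simp add: noise_vec_def)

text \<open>Markov's inequality with remainder: at a new visit \<open>sol n\<close> lies in
  \<open>Xu\<close>, where \<open>g\<close> is at least \<open>1\<close>, while paths still avoiding
  \<open>Xu\<close> keep their mean. Keeping this remainder lets the bounds at successive times be
  chained.\<close>

lemma mean_first_visit:
  assumes [measurable]: "g \<in> borel_measurable S" and "\<And>x. x \<in> Xu \<Longrightarrow> 1 \<le> g x"
  shows "emeasure M (avoid J - avoid (insert n J)) + mean (insert n J) n g \<le> mean J n g"
proof -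
  have "emeasure M (avoid J - avoid (insert n J)) + mean (insert n J) n g
      = (\<integral>\<^sup>+\<omega>. indicator (avoid J - avoid (insert n J)) \<omega>
          + indicator (avoid (insert n J)) \<omega> * g (sol n \<omega>) \<partial>M)"
    by (subst nn_integral_add) (auto simp: mean_def)
  also have "\<dots> \<le> mean J n g"
    unfolding mean_def using assms(2)
    by (intro nn_integral_mono) (auto simp: avoid_def indicator_def)
  finally show ?thesis .
qed

text \<open>Ville's inequality along \<open>m, m + k, m + 2 * k, ...\<close>: each sample trades
  part of the mean for visit probability, and the \<open>k\<close>-step drift carries the rest to
  the next sample without increase.\<close>

lemma sampled_visit_le_mean:
  assumes g [measurable]: "g \<in> borel_measurable S" and unsafe: "\<And>x. x \<in> Xu \<Longrightarrow> 1 \<le> g x"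
    and drift: "\<And>x. x \<in> X - Xu \<Longrightarrow> (\<integral>\<^sup>+\<omega>. g (iter_map f k x (noise_vec w k 0 \<omega>)) \<partial>M) \<le> g x"
  shows "emeasure M (avoid {..<m} - avoid (range (\<lambda>i. m + i * k))) \<le> mean {..<m} m g"
proof -
  define J where "J s = {..<m} \<union> (\<lambda>i. m + i * k) ` {..<s}" for s
  have J_Suc: "J (Suc s) = insert (m + s * k) (J s)" for s
    by (auto simp: J_def less_Suc_eq)
  \<comment> \<open>Invariant: the probability of a visit among the first \<open>s\<close> samples
    plus the mean left at the next sample.\<close>
  have *: "emeasure M (avoid {..<m} - avoid (J s)) + mean (J s) (m + s * k) g \<le> mean {..<m} m g" for s
  proof (induction s)
    case 0
    then show ?case by (simp add: J_def)
  next
    case (Suc s)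
    have "mean (J (Suc s)) (m + s * k + k) g \<le> mean (J (Suc s)) (m + s * k) g"
      by (rule mean_drift[OF _ _ g drift]) (auto simp: J_def)
    then have "emeasure M (avoid {..<m} - avoid (J (Suc s))) + mean (J (Suc s)) (m + Suc s * k) g
        \<le> (emeasure M (avoid {..<m} - avoid (J s)) + emeasure M (avoid (J s) - avoid (J (Suc s))))
          + mean (J (Suc s)) (m + s * k) g"
    proof (intro add_mono)
      have "emeasure M (avoid {..<m} - avoid (J (Suc s)))
          \<le> emeasure M ((avoid {..<m} - avoid (J s)) \<union> (avoid (J s) - avoid (J (Suc s))))"
        by (intro emeasure_mono) auto
      also have "\<dots> \<le> emeasure M (avoid {..<m} - avoid (J s)) + emeasure M (avoid (J s) - avoid (J (Suc s)))"
        by (intro emeasure_subadditive) auto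
      finally show "emeasure M (avoid {..<m} - avoid (J (Suc s))) \<le> \<dots>" .
    qed (simp add: ac_simps)
    also have "\<dots> \<le> emeasure M (avoid {..<m} - avoid (J s)) + mean (J s) (m + s * k) g"
      using mean_first_visit[OF g unsafe, of "J s" "m + s * k"]
      by (simp add: J_Suc add.assoc add_left_mono)
    also note Suc.IH
    finally show ?case .
  qed
  have "avoid {..<m} - avoid (range (\<lambda>i. m + i * k)) = (\<Union>s. avoid {..<m} - avoid (J s))"
    by (auto simp: avoid_def J_def)
  \<comment> \<open>Continuity from below passes from finitely many samples to all of them.\<close>
  also have "emeasure M \<dots> = (SUP s. emeasure M (avoid {..<m} - avoid (J s)))"
    by (intro SUP_emeasure_incseq[symmetric] monoI Diff_mono)
      (auto simp: avoid_def J_def intro: less_le_trans)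
  also have "\<dots> \<le> mean {..<m} m g"
  proof (rule SUP_least)
    fix s
    show "emeasure M (avoid {..<m} - avoid (J s)) \<le> mean {..<m} m g"
      by (rule order_trans[OF _ *[of s]]) simp
  qed
  finally show ?thesis .
qed

end

end

section \<open>The safety bound by a union over early and late visits\<close>

theorem mainTheorem3:
  fixes M :: "'o measure"
    and X X0 Xu :: "(real ^ 'n) set"
    and W :: "'w measure"
    and w :: "nat \<Rightarrow> 'o \<Rightarrow> 'w"
    and f :: "(real ^ 'n) \<times> 'w \<Rightarrow> real ^ 'n"
    and \<gamma> c :: real
    and l k :: nat
    and \<alpha> :: "nat \<Rightarrow> real"
    and B :: "nat \<Rightarrow> real ^ 'n \<Rightarrow> real"
    and x0 :: "real ^ 'n"
  assumes "stochastic_system M X X0 W w f"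
    and "Xu \<subseteq> X" and "Xu \<in> sets borel"
    and "0 \<le> \<gamma>" and "\<gamma> \<le> 1" and "1 \<le> k" and "0 \<le> c"
    and "\<And>i. i < l \<Longrightarrow> 0 < \<alpha> i"
    and "\<And>i. i \<le> l \<Longrightarrow> B i \<in> borel_measurable (restrict_space borel X)"
    and "k_IBC_v1 M X X0 w f Xu \<gamma> l k c \<alpha> B"
    and "x0 \<in> X0"
  shows "\<P>(\<omega> in M. \<forall>t. solution f w x0 t \<omega> \<notin> Xu)
    \<ge> 1 - \<gamma> * (1 + real k * (\<Prod>i<l. \<alpha> i) + (\<Sum>t<l - 1. \<Prod>i\<le>t. \<alpha> i))
        - real k * (real k - 1) * c / 2"
proof -
  interpret stochastic_system M X X0 W w f by fact
  have x0: "x0 \<in> X" using \<open>x0 \<in> X0\<close> init_subset by auto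
  note ctx = \<open>Xu \<in> sets borel\<close> \<open>Xu \<subseteq> X\<close> x0
  let ?sol = "solution f w x0"
  define avd where "avd = avoid Xu x0"
  define mn where "mn = mean Xu x0"
  have avd: "avd J = {\<omega> \<in> space M. \<forall>t\<in>J. ?sol t \<omega> \<notin> Xu}" for J
    by (simp add: avd_def avoid_def[OF ctx])
  have avd_sets [measurable]: "avd J \<in> sets M" for J
    unfolding avd_def by (rule avoid_sets[OF ctx])
  have B_init: "B 0 x0 \<le> \<gamma>" and B_nonneg: "\<And>i x. i \<le> l \<Longrightarrow> x \<in> X \<Longrightarrow> 0 \<le> B i x"
    and B_unsafe: "\<And>i x. i \<le> l \<Longrightarrow> x \<in> Xu \<Longrightarrow> 1 \<le> ennreal (B i x)"
    and drift_chain: "\<And>i x. i < l \<Longrightarrow> x \<in> X - Xu \<Longrightarrow>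
      (\<integral>\<^sup>+\<omega>. ennreal (B (Suc i) (f (x, w 0 \<omega>))) \<partial>M) \<le> ennreal (\<alpha> i * B i x)"
    and drift_one: "\<And>x. x \<in> X - Xu \<Longrightarrow>
      (\<integral>\<^sup>+\<omega>. ennreal (B l (f (x, w 0 \<omega>))) \<partial>M) \<le> ennreal (B l x + c)"
    and drift_k: "\<And>x. x \<in> X - Xu \<Longrightarrow>
      (\<integral>\<^sup>+\<omega>. ennreal (B l (iter_map f k x (noise_vec w k 0 \<omega>))) \<partial>M) \<le> ennreal (B l x)"
    using \<open>k_IBC_v1 M X X0 w f Xu \<gamma> l k c \<alpha> B\<close> \<open>x0 \<in> X0\<close> unfolding k_IBC_v1_def by auto
  have B_meas: "(\<lambda>x. ennreal (B i x)) \<in> borel_measurable S" if "i \<le> l" for i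
    using assms(9)[OF that] by simp
  let ?P = "\<lambda>t. \<Prod>i<t. \<alpha> i"
  have P_nonneg: "0 \<le> ?P t" if "t \<le> l" for t
    using assms(8) that by (intro prod_nonneg) (auto intro!: less_imp_le)

  have chain: "mn {..<t} t (\<lambda>x. ennreal (B t x)) \<le> ennreal (\<gamma> * ?P t)" if "t \<le> l" for t
    using that
  proof (induction t)
    case 0
    have "mn {..<0} 0 (\<lambda>x. ennreal (B 0 x)) = (\<integral>\<^sup>+\<omega>. ennreal (B 0 x0) * indicator (space M) \<omega> \<partial>M)"
      unfolding mn_def mean_def[OF ctx] avd_def[symmetric] by (simp add: avd mult.commute)
    also have "\<dots> = ennreal (B 0 x0)"
      by (subst nn_integral_cmult_indicator) (auto simp: emeasure_space_1)
    finally have "mn {..<0} 0 (\<lambda>x. ennreal (B 0 x)) = ennreal (B 0 x0)" .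
    then show ?case using B_init by (simp add: ennreal_leI)
  next
    case (Suc t)
    then have t: "t < l" by simp
    have "mn {..<Suc t} (Suc t) (\<lambda>x. ennreal (B (Suc t) x))
        \<le> mn {..<Suc t} t (\<lambda>x. ennreal (\<alpha> t * B t x))"
      unfolding mn_def using t
      by (intro mean_drift_one[OF ctx _ _ B_meas drift_chain[OF t]]) auto
    \<comment> \<open>Once the drift has been used, time \<open>t\<close> leaves the watched set, as
      the induction hypothesis requires; this can only enlarge the event.\<close>
    also have "\<dots> \<le> mn {..<t} t (\<lambda>x. ennreal (\<alpha> t) * ennreal (B t x))"
      unfolding mn_def using assms(8)[OF t] t B_nonneg
      by (intro mean_mono[OF ctx]) (auto simp: ennreal_mult')
    also have "\<dots> = ennreal (\<alpha> t) * mn {..<t} t (\<lambda>x. ennreal (B t x))"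
      unfolding mn_def using t by (intro mean_cmult[OF ctx] B_meas) simp
    also have "\<dots> \<le> ennreal (\<alpha> t) * ennreal (\<gamma> * ?P t)"
      using Suc by (intro mult_left_mono) auto
    also have "\<dots> = ennreal (\<gamma> * ?P (Suc t))"
      using assms(8)[OF t] by (simp add: ennreal_mult'[symmetric] mult_ac)
    finally show ?case by simp
  qed

  \<comment> \<open>Beyond time \<open>l\<close> the barrier stays \<open>B l\<close> and each
    single step costs at most \<open>c\<close>; this gives the starting mean for residue class
    \<open>j\<close>.\<close>
  have shifted: "mn {..<l + j} (l + j) (\<lambda>x. ennreal (B l x)) \<le> ennreal (\<gamma> * ?P l + real j * c)" for j
  proof (induction j)
    case 0
    then show ?case using chain[of l] by simp
  next
    case (Suc j)
    have "mn {..<l + Suc j} (Suc (l + j)) (\<lambda>x. ennreal (B l x))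
        \<le> mn {..<l + Suc j} (l + j) (\<lambda>x. ennreal (B l x + c))"
      unfolding mn_def
      by (intro mean_drift_one[OF ctx _ _ B_meas drift_one]) auto
    also have "\<dots> \<le> mn {..<l + j} (l + j) (\<lambda>x. ennreal (B l x) + ennreal c)"
      unfolding mn_def using \<open>0 \<le> c\<close> B_nonneg
      by (intro mean_mono[OF ctx]) auto
    also have "\<dots> \<le> mn {..<l + j} (l + j) (\<lambda>x. ennreal (B l x)) + ennreal c"
      unfolding mn_def by (intro mean_add_const_le[OF ctx] B_meas) simp
    also have "\<dots> \<le> ennreal (\<gamma> * ?P l + real j * c) + ennreal c"
      using Suc.IH by (rule add_right_mono)
    also have "\<dots> = ennreal (\<gamma> * ?P l + real (Suc j) * c)"
      using \<open>0 \<le> c\<close> \<open>0 \<le> \<gamma>\<close> P_nonneg[of l]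
      by (subst ennreal_plus[symmetric]) (auto simp: algebra_simps)
    finally show ?case by simp
  qed

  define early where "early t = avd {..<t} - avd (insert t {..<t})" for t
  \<comment> \<open>Times of the other residue classes after \<open>l + j\<close> are not watched,
    so these events may overlap for different \<open>j\<close>; a union bound suffices.\<close>
  define late where "late j = avd {..<l + j} - avd (range (\<lambda>i. l + j + i * k))" for j
  have early_le: "measure M (early t) \<le> \<gamma> * ?P t" if "t < l" for t
  proof -
    have "emeasure M (early t) \<le> mn {..<t} t (\<lambda>x. ennreal (B t x))"
      unfolding early_def avd_def mn_def using that
      by (intro order_trans[OF _ mean_first_visit[OF ctx B_meas B_unsafe]]) auto
    also have "\<dots> \<le> ennreal (\<gamma> * ?P t)"
      using that by (intro chain) simp
    finally show ?thesis
      using \<open>0 \<le> \<gamma>\<close> P_nonneg[of t] that by (simp add: emeasure_eq_measure)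
  qed
  have late_le: "measure M (late j) \<le> \<gamma> * ?P l + real j * c" for j
  proof -
    have "emeasure M (late j) \<le> mn {..<l + j} (l + j) (\<lambda>x. ennreal (B l x))"
      unfolding late_def avd_def mn_def
      by (rule sampled_visit_le_mean[OF ctx B_meas B_unsafe drift_k]) auto
    also note shifted
    finally show ?thesis
      using \<open>0 \<le> \<gamma>\<close> \<open>0 \<le> c\<close> P_nonneg[of l] by (simp add: emeasure_eq_measure del: ennreal_plus)
  qed

  \<comment> \<open>The first visit time \<open>t\<close> decides: if \<open>t < l\<close> the path
    is in \<open>early t\<close>, otherwise in \<open>late j\<close> with \<open>j\<close> the
    remainder of \<open>t - l\<close> modulo \<open>k\<close>, since by minimality all times before
    \<open>l + j \<le> t\<close> are safe.\<close>
  have cover: "space M - avd UNIV \<subseteq> (\<Union>t<l. early t) \<union> (\<Union>j<k. late j)"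
  proof
    fix \<omega> assume \<omega>: "\<omega> \<in> space M - avd UNIV"
    define t where "t = (LEAST t. ?sol t \<omega> \<in> Xu)"
    have t: "?sol t \<omega> \<in> Xu"
      using \<omega> unfolding t_def avd by (auto intro: LeastI_ex)
    have before: "?sol s \<omega> \<notin> Xu" if "s < t" for s
      using that unfolding t_def by (rule not_less_Least)
    show "\<omega> \<in> (\<Union>t<l. early t) \<union> (\<Union>j<k. late j)"
    proof (cases "t < l")
      case True
      then have "\<omega> \<in> early t"
        using \<omega> t before by (auto simp: early_def avd)
      with True show ?thesis by blast
    next
      case False
      define j where "j = (t - l) mod k"
      have eq: "t = l + j + (t - l) div k * k"
        using False by (simp add: j_def)
      then have "t \<in> range (\<lambda>i. l + j + i * k)" by (rule range_eqI)
      moreover have "l + j \<le> t" by (subst eq) simp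
      ultimately have "\<omega> \<in> late j"
        using \<omega> t before unfolding late_def avd by fastforce
      moreover have "j < k" using \<open>1 \<le> k\<close> by (simp add: j_def)
      ultimately show ?thesis by blast
    qed
  qed
  have [measurable]: "early t \<in> sets M" "late j \<in> sets M" for t j
    by (auto simp: early_def late_def)
  have "measure M (space M - avd UNIV) \<le> measure M ((\<Union>t<l. early t) \<union> (\<Union>j<k. late j))"
    using cover by (intro finite_measure_mono) auto
  also have "\<dots> \<le> measure M (\<Union>t<l. early t) + measure M (\<Union>j<k. late j)"
    by (intro measure_Un_le) auto
  also have "\<dots> \<le> (\<Sum>t<l. measure M (early t)) + (\<Sum>j<k. measure M (late j))"
    by (intro add_mono finite_measure_subadditive_finite) auto
  also have "\<dots> \<le> (\<Sum>t<l. \<gamma> * ?P t) + (\<Sum>j<k. \<gamma> * ?P l + real j * c)"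
    by (intro add_mono sum_mono early_le late_le) auto
  \<comment> \<open>The costs \<open>j * c\<close> of reaching the \<open>k\<close> residue classes
    add up to the last term of the bound.\<close>
  also have "(\<Sum>j<k. \<gamma> * ?P l + real j * c) = \<gamma> * (real k * ?P l) + real k * (real k - 1) * c / 2"
    by (induction k) (auto simp: field_simps)
  \<comment> \<open>For \<open>l > 0\<close> this is an equality: the empty product at
    \<open>t = 0\<close> gives the \<open>1\<close>, and the rest is an index shift. For
    \<open>l = 0\<close> the left side is empty and \<open>l - 1\<close> truncates to
    \<open>0\<close>, leaving \<open>0 \<le> \<gamma>\<close>.\<close>
  also have "(\<Sum>t<l. \<gamma> * ?P t) \<le> \<gamma> * (1 + (\<Sum>t<l - 1. \<Prod>i\<le>t. \<alpha> i))"
  proof (cases l)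
    case (Suc l')
    have "(\<Sum>t<l. ?P t) = 1 + (\<Sum>t<l'. \<Prod>i\<le>t. \<alpha> i)"
      unfolding Suc by (subst sum.lessThan_Suc_shift) (simp add: lessThan_Suc_atMost del: prod.lessThan_Suc)
    then show ?thesis
      using Suc by (simp add: sum_distrib_left[symmetric])
  qed (use \<open>0 \<le> \<gamma>\<close> in simp)
  finally have "measure M (space M - avd UNIV)
      \<le> \<gamma> * (1 + real k * ?P l + (\<Sum>t<l - 1. \<Prod>i\<le>t. \<alpha> i)) + real k * (real k - 1) * c / 2"
    by (simp add: distrib_left)
  moreover have "avd UNIV = {\<omega> \<in> space M. \<forall>t. ?sol t \<omega> \<notin> Xu}"
    by (simp add: avd)
  then have "measure M (space M - avd UNIV) = 1 - \<P>(\<omega> in M. \<forall>t. ?sol t \<omega> \<notin> Xu)"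
    using prob_compl[OF avd_sets, of UNIV] by (simp only:)
  ultimately show ?thesis by simp
qed

end
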